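(* Let $G=(V,E)$ be a finite graph whose set $W$ of vertices of odd degree is non-empty, let $p\in(\frac12,1)$, and let $r=2(1-p)$. Let $\omega$ be a random element of $\Omega^W$ with law $\phi^W_{r,2}$, the random-cluster measure on $G$ with parameters $r$ and $q=2$ conditioned on the event $\Omega^W$. Conditionally on $\omega$, let $\gamma$ be a uniformly chosen random even subset of $\eta(\omega)$. Then the graph $S=(V,\,E\setminus(\gamma\bigtriangleup P_\omega))$ is a random even subgraph of $G$ with parameter $p$; that is, the random set $E\setminus(\gamma\bigtriangleup P_\omega)$ has law $\rho_p$.
   Context: A subset $F\subseteq E$ is called even if every vertex $x\in V$ is incident to an even number of elements of $F$; $\mathcal E$ denotes the set of all even subsets of $E$. For $p\in[0,1)$ the random even subgraph of $G$ with parameter $p$ is the one with law $\rho_p(F)=\frac1{Z^{\rm E}}p^{|F|}(1-p)^{|E\setminus F|}$, $F\in\mathcal E$, where $Z^{\rm E}$ is the normalizing constant. $\bigtriangleup$ denotes symmetric difference. For $\omega\in\Omega=\{0,1\}^E$, $\eta(\omega)=\{e\in E:\omega(e)=1\}$ is the set of open edges, and $k(\omega)$ is the number of connected components of $(V,\eta(\omega))$ (isolated vertices included). The random-cluster measure on $G$ with parameters $r\in(0,1)$ and $q=2$ is $\phi_{r,2}(\omega)=\frac1{Z^{\rm RC}}\,r^{|\eta(\omega)|}(1-r)^{|E\setminus\eta(\omega)|}2^{k(\omega)}$, $\omega\in\Omega$, with $Z^{\rm RC}$ the normalizing constant. For $W\subseteq V$ and $H\subseteq E$, $H$ is called $W$-even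 if each connected component of $(V,H)$ contains an even number of members of $W$. $\Omega^W=\{\omega\in\Omega:\eta(\omega)\text{ is }W\text{-even}\}$. For each $\omega\in\Omega^W$ we fix (as a function of $\omega$) pairwise disjoint subsets $P^i_\omega$, $i=1,\dots,\frac12|W|$, of $\eta(\omega)$, each of which is the edge-set of a non-self-intersecting path with distinct endpoints lying in $W$, such that every member of $W$ is an endpoint of exactly one of these paths; and $P_\omega=\bigcup_i P^i_\omega$. *)

theory Defs
  imports "HOL-Probability.Probability"
begin

text \<open>Finite graphs. Parallel edges and loops are permitted, so edges are abstract and
  \<open>ends G e\<close> is the set of endpoints of \<open>e\<close>, a singleton if \<open>e\<close> is a loop. Simple graphs are
  the special case in which \<open>ends G\<close> is injective and has two-element values.\<close>

record ('v, 'e) graph =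
  verts :: "'v set"
  edges :: "'e set"
  ends :: "'e \<Rightarrow> 'v set"

definition finite_graph :: "('v, 'e) graph \<Rightarrow> bool" where
  "finite_graph G \<longleftrightarrow> finite (verts G) \<and> finite (edges G) \<and>
     (\<forall>e\<in>edges G. ends G e \<subseteq> verts G \<and> card (ends G e) \<in> {1, 2})"

text \<open>The number of incidences of \<open>x\<close> with elements of \<open>F\<close>. As usual, a loop counts twice;
  without loops the second summand is zero.\<close>

definition vdegree :: "('v, 'e) graph \<Rightarrow> 'e set \<Rightarrow> 'v \<Rightarrow> nat" where
  "vdegree G F x = card {e\<in>F. x \<in> ends G e} + card {e\<in>F. ends G e = {x}}"

definition odd_verts :: "('v, 'e) graph \<Rightarrow> 'v set" where
  "odd_verts G = {x\<in>verts G. odd (vdegree G (edges G) x)}"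

definition even_subsets :: "('v, 'e) graph \<Rightarrow> 'e set \<Rightarrow> 'e set set" where
  "even_subsets G H = {F. F \<subseteq> H \<and> (\<forall>x\<in>verts G. even (vdegree G F x))}"

text \<open>The probability law on the finite set \<open>A\<close> proportional to the weight function \<open>w\<close>.\<close>

definition weighted_pmf :: "'a set \<Rightarrow> ('a \<Rightarrow> real) \<Rightarrow> 'a pmf" where
  "weighted_pmf A w = embed_pmf (\<lambda>x. if x \<in> A then w x / (\<Sum>y\<in>A. w y) else 0)"

lemma pmf_weighted_pmf:
  assumes "finite A" "\<And>x. x \<in> A \<Longrightarrow> 0 \<le> w x" "0 < (\<Sum>y\<in>A. w y)"
  shows "pmf (weighted_pmf A w) x = (if x \<in> A then w x / (\<Sum>y\<in>A. w y) else 0)"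
proof -
  let ?f = "\<lambda>x. if x \<in> A then w x / (\<Sum>y\<in>A. w y) else 0"
  have nonneg: "0 \<le> ?f x" for x
    using assms by simp
  have "(\<integral>\<^sup>+ x. ennreal (?f x) \<partial>count_space UNIV) = (\<Sum>x\<in>A. ennreal (?f x))"
    by (rule nn_integral_count_space') (use assms in auto)
  also have "\<dots> = ennreal (\<Sum>x\<in>A. ?f x)"
    using nonneg by (rule sum_ennreal)
  also have "(\<Sum>x\<in>A. ?f x) = 1"
    using assms(3) by (simp flip: sum_divide_distrib)
  finally show ?thesis
    unfolding weighted_pmf_def by (intro pmf_embed_pmf nonneg) simp
qed

definition random_even :: "('v, 'e) graph \<Rightarrow> real \<Rightarrow> 'e set pmf" where
  "random_even G p = weighted_pmf (even_subsets G (edges G))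
     (\<lambda>F. p ^ card F * (1 - p) ^ card (edges G - F))"

text \<open>The connected components of the spanning subgraph with edge set \<open>H\<close>, as vertex sets;
  isolated vertices are singleton components.\<close>

definition graph_components :: "('v, 'e) graph \<Rightarrow> 'e set \<Rightarrow> 'v set set" where
  "graph_components G H = verts G // {(x, y). x \<in> verts G \<and> y \<in> verts G \<and>
     (x, y) \<in> {(u, v). \<exists>e\<in>H. ends G e = {u, v}}\<^sup>*}"

definition configs :: "('v, 'e) graph \<Rightarrow> ('e \<Rightarrow> nat) set" where
  "configs G = edges G \<rightarrow>\<^sub>E {0, 1}"

definition open_edges :: "('v, 'e) graph \<Rightarrow> ('e \<Rightarrow> nat) \<Rightarrow> 'e set" where
  "open_edges G \<omega> = {e\<in>edges G. \<omega> e = 1}"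

definition random_cluster :: "('v, 'e) graph \<Rightarrow> real \<Rightarrow> real \<Rightarrow> ('e \<Rightarrow> nat) pmf" where
  "random_cluster G r q = weighted_pmf (configs G)
     (\<lambda>\<omega>. r ^ card (open_edges G \<omega>) * (1 - r) ^ card (edges G - open_edges G \<omega>) *
          q ^ card (graph_components G (open_edges G \<omega>)))"

definition W_even :: "('v, 'e) graph \<Rightarrow> 'v set \<Rightarrow> 'e set \<Rightarrow> bool" where
  "W_even G W H \<longleftrightarrow> (\<forall>C\<in>graph_components G H. even (card (C \<inter> W)))"

definition W_even_configs :: "('v, 'e) graph \<Rightarrow> 'v set \<Rightarrow> ('e \<Rightarrow> nat) set" where
  "W_even_configs G W = {\<omega>\<in>configs G. W_even G W (open_edges G \<omega>)}"

text \<open>\<open>F\<close> is the edge-set of a non-self-intersecting path from \<open>x\<close> to \<open>y\<close>: the vertices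
  \<open>vs\<close> are visited in order, via the edges \<open>es\<close>.\<close>

definition path_edge_set :: "('v, 'e) graph \<Rightarrow> 'v \<Rightarrow> 'v \<Rightarrow> 'e set \<Rightarrow> bool" where
  "path_edge_set G x y F \<longleftrightarrow> (\<exists>vs es.
     set vs \<subseteq> verts G \<and> set es \<subseteq> edges G \<and> distinct vs \<and> length vs = Suc (length es) \<and>
     (\<forall>i<length es. ends G (es ! i) = {vs ! i, vs ! Suc i}) \<and>
     hd vs = x \<and> last vs = y \<and> set es = F)"

text \<open>\<open>P 1, \<dots>, P (|W|/2)\<close> are pairwise disjoint subsets of \<open>H\<close>, where \<open>P i\<close> is the edge-set of
  a path with endpoints \<open>a i \<noteq> b i\<close>, and these paths pair up the members of \<open>W\<close>.\<close>

definition W_pairing :: "('v, 'e) graph \<Rightarrow> 'v set \<Rightarrow> 'e set \<Rightarrow> (nat \<Rightarrow> 'e set) \<Rightarrow> bool" where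
  "W_pairing G W H P \<longleftrightarrow>
     disjoint_family_on P {1..card W div 2} \<and>
     (\<exists>a b. (\<forall>i\<in>{1..card W div 2}. P i \<subseteq> H \<and> a i \<in> W \<and> b i \<in> W \<and> a i \<noteq> b i \<and>
               path_edge_set G (a i) (b i) (P i)) \<and>
            (\<forall>w\<in>W. \<exists>!i. i \<in> {1..card W div 2} \<and> w \<in> {a i, b i}))"

end

theory Submission
  imports Defs
begin

text \<open>Fix an even \<open>F\<close> and put \<open>D = E - F\<close>, whose odd vertices are those of \<open>W\<close>. As \<open>P\<^sub>\<omega>\<close> has the same
  odd vertices, \<open>\<gamma> \<mapsto> E - sym_diff \<gamma> P\<^sub>\<omega>\<close> is a bijection from the even subsets of \<open>\<eta>(\<omega>)\<close> to the even
  \<open>F\<close> with \<open>D \<subseteq> \<eta>(\<omega>)\<close>, and the latter inclusion already forces \<open>\<omega> \<in> \<Omega>\<^sup>W\<close>. Since \<open>H\<close> has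
  \<open>2 ^ (|H| - |V| + k(H))\<close> even subsets, dividing the random-cluster weight by their number cancels
  \<open>2 ^ k\<close> and replaces \<open>r\<close> by \<open>r/2 = 1 - p\<close>. The remaining weight is a product over edges, and
  summing it over all \<open>\<omega>\<close> with \<open>D \<subseteq> \<eta>(\<omega>)\<close> gives a multiple of \<open>(1 - p) ^ |D| * p ^ |F|\<close>.\<close>

section \<open>Degrees modulo two\<close>

lemma finite_graph_simps:
  assumes "finite_graph G"
  shows "finite (verts G)" "finite (edges G)" "F \<subseteq> edges G \<Longrightarrow> finite F"
  using assms by (auto simp: finite_graph_def intro: finite_subset)

lemma ends_cases:
  assumes "finite_graph G" "e \<in> edges G"
  obtains u v where "ends G e = {u, v}" "u \<in> verts G" "v \<in> verts G"
proof -
  have "ends G e \<subseteq> verts G" "card (ends G e) = 1 \<or> card (ends G e) = 2"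
    using assms by (auto simp: finite_graph_def)
  then show thesis
    by (auto simp: card_1_singleton_iff card_2_iff intro: that)
qed

lemma vdegree_singleton:
  "vdegree G {e} x = of_bool (x \<in> ends G e) + of_bool (ends G e = {x})"
proof -
  have "{e' \<in> {e}. Q e'} = (if Q e then {e} else {})" for Q
    by auto
  then show ?thesis
    by (simp add: vdegree_def)
qed

lemma vdegree_eq_sum:
  assumes "finite F"
  shows "vdegree G F x = (\<Sum>e\<in>F. vdegree G {e} x)"
  using assms
  unfolding vdegree_singleton sum.distrib
  by (simp add: vdegree_def sum_of_bool_eq Collect_conj_eq)

text \<open>The loop case \<open>u = v\<close> is covered: a loop counts twice, so it leaves every
  parity even.\<close>

lemma even_vdegree_edge:
  assumes "ends G e = {u, v}"
  shows "even (vdegree G {e} x) \<longleftrightarrow> (x = u \<longleftrightarrow> x = v)"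
  using assms by (auto simp: vdegree_singleton)

text \<open>Edges of \<open>A \<inter> B\<close> are counted once for \<open>A\<close> and once for
  \<open>B\<close>, so they cancel modulo two.\<close>

lemma even_vdegree_sym_diff:
  assumes "finite A" "finite B"
  shows "even (vdegree G (sym_diff A B) x) \<longleftrightarrow> (even (vdegree G A x) \<longleftrightarrow> even (vdegree G B x))"
proof -
  let ?s = "sum (\<lambda>e. vdegree G {e} x)"
  have "?s A = ?s (A - B) + ?s (A \<inter> B)" "?s B = ?s (B - A) + ?s (A \<inter> B)"
    using sum.Int_Diff[OF assms(1), of _ B] sum.Int_Diff[OF assms(2), of _ A]
    by (simp_all add: Int_commute add.commute)
  moreover have "?s (sym_diff A B) = ?s (A - B) + ?s (B - A)"
    using assms by (auto intro: sum.union_disjoint)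
  ultimately have "?s A + ?s B = ?s (sym_diff A B) + 2 * ?s (A \<inter> B)"
    by simp
  then have "vdegree G A x + vdegree G B x = vdegree G (sym_diff A B) x + 2 * ?s (A \<inter> B)"
    using assms by (simp add: vdegree_eq_sum[of A] vdegree_eq_sum[of B] vdegree_eq_sum[of "sym_diff A B"])
  then show ?thesis
    by presburger
qed

lemma even_vdegree_path:
  assumes "path_edge_set G a b F" "a \<noteq> b"
  shows "even (vdegree G F x) \<longleftrightarrow> x \<notin> {a, b}"
proof -
  obtain vs es where *: "distinct vs" "length vs = Suc (length es)"
    "\<And>i. i < length es \<Longrightarrow> ends G (es ! i) = {vs ! i, vs ! Suc i}"
    "hd vs = a" "last vs = b" "set es = F"
    using assms(1) by (auto simp: path_edge_set_def)
  \<comment> \<open>Vertices are not repeated, so an edge determines its position on the path. Hence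
    the degree of the edge set is a sum along the list \<open>es\<close>.\<close>
  have "i = j" if "i < length es" "j < length es" "es ! i = es ! j" for i j
  proof -
    have "{vs ! i, vs ! Suc i} = {vs ! j, vs ! Suc j}"
      using that *(3) by metis
    then show ?thesis
      using that *(1,2) by (auto simp: doubleton_eq_iff nth_eq_iff_index_eq)
  qed
  then have "distinct es"
    by (auto simp: distinct_conv_nth)
  then have deg: "vdegree G F x = (\<Sum>i<length es. vdegree G {es ! i} x)"
    using *(6) by (auto simp: vdegree_eq_sum[of "set es"] sum.distinct_set_conv_list sum_list_sum_nth
        lessThan_atLeast0 intro!: sum.cong)
  \<comment> \<open>The first \<open>n\<close> edges lead from \<open>vs ! 0\<close> to
    \<open>vs ! n\<close>. The next edge flips the parity at \<open>vs ! n\<close> and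
    \<open>vs ! Suc n\<close>, which only moves the far end.\<close>
  have "even (\<Sum>i<n. vdegree G {es ! i} x) \<longleftrightarrow> (x = vs ! 0 \<longleftrightarrow> x = vs ! n)" if "n \<le> length es" for n
    using that by (induction n) (use even_vdegree_edge[OF *(3)] in auto)
  from this[of "length es"] have "even (vdegree G F x) \<longleftrightarrow> (x = a \<longleftrightarrow> x = b)"
    using deg *(2) hd_conv_nth[of vs] last_conv_nth[of vs] unfolding *(4,5) by (cases "vs = []") auto
  then show ?thesis
    using assms(2) by auto
qed

text \<open>Degrees add up because the paths are disjoint. Modulo two, each path contributes only at
  its two endpoints, and each member of \<open>W\<close> is an endpoint of exactly one path.\<close>

lemma even_vdegree_W_pairing:
  assumes "finite_graph G" "H \<subseteq> edges G" "W_pairing G W H P"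
  shows "even (vdegree G (\<Union>i\<in>{1..card W div 2}. P i) x) \<longleftrightarrow> x \<notin> W"
proof -
  let ?I = "{1..card W div 2}"
  obtain a b where ab: "\<And>i. i \<in> ?I \<Longrightarrow> P i \<subseteq> H \<and> a i \<in> W \<and> b i \<in> W \<and> a i \<noteq> b i \<and>
       path_edge_set G (a i) (b i) (P i)"
    "\<forall>w\<in>W. \<exists>!i. i \<in> ?I \<and> w \<in> {a i, b i}"
    using assms(3) unfolding W_pairing_def by blast
  have fin: "finite (P i)" if "i \<in> ?I" for i
    using ab(1)[OF that] assms(1,2) by (meson finite_graph_simps(3) order_trans)
  have "vdegree G (\<Union>i\<in>?I. P i) x = (\<Sum>e\<in>(\<Union>i\<in>?I. P i). vdegree G {e} x)"
    using fin by (intro vdegree_eq_sum) auto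
  also have "\<dots> = (\<Sum>i\<in>?I. \<Sum>e\<in>P i. vdegree G {e} x)"
    using fin assms(3)
    by (intro sum.UNION_disjoint) (auto simp: W_pairing_def disjoint_family_on_def)
  also have "\<dots> = (\<Sum>i\<in>?I. vdegree G (P i) x)"
    using fin by (intro sum.cong refl vdegree_eq_sum[symmetric])
  finally have "even (vdegree G (\<Union>i\<in>?I. P i) x) \<longleftrightarrow> even (card {i\<in>?I. odd (vdegree G (P i) x)})"
    by (simp add: even_sum_iff)
  also have "{i\<in>?I. odd (vdegree G (P i) x)} = {i\<in>?I. x \<in> {a i, b i}}"
    using ab(1) even_vdegree_path[of G _ _ _ x] by blast
  also have "even (card \<dots>) \<longleftrightarrow> x \<notin> W"
  proof (cases "x \<in> W")
    case True
    then obtain i where "{i\<in>?I. x \<in> {a i, b i}} = {i}"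
      using ab(2) by blast
    then show ?thesis using True by simp
  next
    case False
    then have "{i\<in>?I. x \<in> {a i, b i}} = {}"
      using ab(1) by blast
    then show ?thesis using False by (simp only: card.empty) simp
  qed
  finally show ?thesis .
qed

section \<open>Spins and the number of even subgraphs\<close>

text \<open>This is the product of the spins at the two ends of \<open>e\<close>. Using the degree
  as exponent gives a loop the square of its spin and makes products over edge sets produce
  \<open>vdegree\<close>.\<close>

definition edge_sign :: "('v, 'e) graph \<Rightarrow> ('v \<Rightarrow> int) \<Rightarrow> 'e \<Rightarrow> int" where
  "edge_sign G \<sigma> e = (\<Prod>x\<in>verts G. \<sigma> x ^ vdegree G {e} x)"

lemma prod_edge_sign:
  assumes "finite F"
  shows "(\<Prod>e\<in>F. edge_sign G \<sigma> e) = (\<Prod>x\<in>verts G. \<sigma> x ^ vdegree G F x)"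
  unfolding edge_sign_def vdegree_eq_sum[OF assms]
  by (subst prod.swap) (simp add: power_sum)

lemma edge_sign_eq:
  assumes "finite (verts G)" "ends G e = {u, v}" "u \<in> verts G" "v \<in> verts G"
  shows "edge_sign G \<sigma> e = \<sigma> u * \<sigma> v"
proof -
  have "\<sigma> x ^ vdegree G {e} x = (if x = u then \<sigma> x else 1) * (if x = v then \<sigma> x else 1)" for x
    using assms(2) by (auto simp: vdegree_singleton)
  then show ?thesis
    using assms by (simp add: edge_sign_def prod.distrib)
qed

text \<open>This names the relation whose classes are the components, so that facts about
  equivalences apply.\<close>

definition connected_rel :: "('v, 'e) graph \<Rightarrow> 'e set \<Rightarrow> ('v \<times> 'v) set" where
  "connected_rel G H = {(x, y). x \<in> verts G \<and> y \<in> verts G \<and>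
     (x, y) \<in> {(u, v). \<exists>e\<in>H. ends G e = {u, v}}\<^sup>*}"

lemma graph_components_eq: "graph_components G H = verts G // connected_rel G H"
  by (simp add: graph_components_def connected_rel_def)

lemma equiv_connected_rel: "equiv (verts G) (connected_rel G H)"
proof -
  have "sym {(u, v). \<exists>e\<in>H. ends G e = {u, v}}"
    by (auto simp: sym_def insert_commute)
  then have "sym ({(u, v). \<exists>e\<in>H. ends G e = {u, v}}\<^sup>*)"
    by (rule sym_rtrancl)
  then show ?thesis
    by (intro equivI)
      (auto simp: connected_rel_def refl_on_def sym_def intro!: transI intro: rtrancl_trans)
qed

lemma connected_relI_edge:
  assumes "e \<in> H" "ends G e = {u, v}" "u \<in> verts G" "v \<in> verts G"
  shows "(u, v) \<in> connected_rel G H"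
  using assms by (auto simp: connected_rel_def)

text \<open>Two spins from \<open>{1, -1}\<close> have product 1 exactly if they agree, and
  agreement across edges propagates along walks.\<close>

lemma edge_sign_eq_1_iff:
  assumes "finite_graph G" "H \<subseteq> edges G" "\<And>x. x \<in> verts G \<Longrightarrow> \<sigma> x \<in> {1, -1}"
  shows "(\<forall>e\<in>H. edge_sign G \<sigma> e = 1) \<longleftrightarrow> (\<forall>(x, y)\<in>connected_rel G H. \<sigma> x = \<sigma> y)"
proof -
  have sign: "edge_sign G \<sigma> e = 1 \<longleftrightarrow> \<sigma> u = \<sigma> v"
    if "ends G e = {u, v}" "e \<in> H" for e u v
  proof -
    have "ends G e \<subseteq> verts G"
      using assms(1,2) that(2) unfolding finite_graph_def by blast
    then have "u \<in> verts G" "v \<in> verts G"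
      using that(1) by auto
    then show ?thesis
      using edge_sign_eq[of G e u v \<sigma>] that assms(3)[of u] assms(3)[of v]
        finite_graph_simps(1)[OF assms(1)] by auto
  qed
  show ?thesis
  proof (intro iffI ballI)
    fix z assume edges: "\<forall>e\<in>H. edge_sign G \<sigma> e = 1" and "z \<in> connected_rel G H"
    then obtain x y where z: "z = (x, y)"
      and path: "(x, y) \<in> {(u, v). \<exists>e\<in>H. ends G e = {u, v}}\<^sup>*"
      by (auto simp: connected_rel_def)
    from path have "\<sigma> x = \<sigma> y"
      by induction (use edges sign in auto)
    then show "case z of (x, y) \<Rightarrow> \<sigma> x = \<sigma> y"
      by (simp add: z)
  next
    fix e assume const: "\<forall>(x, y)\<in>connected_rel G H. \<sigma> x = \<sigma> y" and e: "e \<in> H"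
    obtain u v where "ends G e = {u, v}" "u \<in> verts G" "v \<in> verts G"
      by (rule ends_cases[OF assms(1) subsetD[OF assms(2) e]])
    then show "edge_sign G \<sigma> e = 1"
      using const sign[of e u v] connected_relI_edge[of e H G u v] e by auto
  qed
qed

text \<open>A function constant on classes is the same as a function on the quotient. With two spin
  values this produces the factor \<open>2 ^ k\<close>, where \<open>k\<close> is the number of
  components.\<close>

lemma card_respecting_functions:
  assumes "equiv A R" "finite A"
  shows "card {f \<in> A \<rightarrow>\<^sub>E B. \<forall>(x, y)\<in>R. f x = f y} = card B ^ card (A // R)"
proof -
  have "bij_betw (\<lambda>g. \<lambda>x\<in>A. g (R `` {x})) (A // R \<rightarrow>\<^sub>E B) {f \<in> A \<rightarrow>\<^sub>E B. \<forall>(x, y)\<in>R. f x = f y}"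
    (is "bij_betw ?h _ ?S")
  proof (rule bij_betw_imageI)
    show "inj_on ?h (A // R \<rightarrow>\<^sub>E B)"
    proof (rule inj_onI)
      fix g g' assume g: "g \<in> A // R \<rightarrow>\<^sub>E B" "g' \<in> A // R \<rightarrow>\<^sub>E B" and eq: "?h g = ?h g'"
      show "g = g'"
      proof (rule PiE_ext[OF g])
        fix C assume "C \<in> A // R"
        then obtain x where "x \<in> A" "C = R `` {x}"
          by (rule quotientE)
        then show "g C = g' C"
          using fun_cong[OF eq, of x] by simp
      qed
    qed
    show "?h ` (A // R \<rightarrow>\<^sub>E B) = ?S"
    proof (intro equalityI subsetI)
      fix f assume "f \<in> ?h ` (A // R \<rightarrow>\<^sub>E B)"
      then obtain g where g: "g \<in> A // R \<rightarrow>\<^sub>E B" "f = ?h g"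
        by blast
      have "f x = f y" if "(x, y) \<in> R" for x y
        using that g(2) equiv_class_eq[OF assms(1) that] equiv_type[OF assms(1)] by auto
      then show "f \<in> ?S"
        using g by (auto intro: quotientI)
    next
      fix f assume f: "f \<in> ?S"
      \<comment> \<open>The chosen representative is immaterial, since \<open>f\<close> is constant
        on each class.\<close>
      define g where "g = (\<lambda>C\<in>A // R. f (SOME x. x \<in> C))"
      have some: "(SOME y. y \<in> R `` {x}) \<in> R `` {x}" if "x \<in> A" for x
        by (rule someI) (rule equiv_class_self[OF assms(1) that])
      have "g (R `` {x}) = f x" if "x \<in> A" for x
        using some[OF that] f that by (auto simp: g_def quotientI)
      then have "?h g = f"
        using f by (intro PiE_ext[of _ A "\<lambda>_. UNIV" f]) (auto simp: PiE_iff)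
      moreover have "g \<in> A // R \<rightarrow>\<^sub>E B"
      proof (rule PiE_I)
        fix C assume "C \<in> A // R"
        then obtain x where "x \<in> A" "C = R `` {x}"
          by (rule quotientE)
        then show "g C \<in> B"
          using \<open>\<And>x. x \<in> A \<Longrightarrow> g (R `` {x}) = f x\<close> f by (auto simp: PiE_iff)
      qed (simp add: g_def)
      ultimately show "f \<in> ?h ` (A // R \<rightarrow>\<^sub>E B)"
        by blast
    qed
  qed
  then have "card ?S = card (A // R \<rightarrow>\<^sub>E B)"
    by (simp add: bij_betw_same_card)
  then show ?thesis
    using assms finite_quotient[of A R] by (simp add: card_PiE equiv_type)
qed

lemma finite_even_subsets:
  assumes "finite H"
  shows "finite (even_subsets G H)"
  by (rule finite_subset[of _ "Pow H"]) (auto simp: even_subsets_def assms)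

text \<open>Evaluate the sum over all spin assignments \<open>\<sigma>\<close> of \<open>\<Prod>e\<in>H. 1 + edge_sign G \<sigma> e\<close> in two ways:
  the product vanishes unless \<open>\<sigma>\<close> is constant on components, and expanding it leaves
  only the even subsets of \<open>H\<close>.\<close>

lemma card_even_subsets:
  assumes "finite_graph G" "H \<subseteq> edges G"
  shows "card (even_subsets G H) * 2 ^ card (verts G) =
         2 ^ card H * 2 ^ card (graph_components G H)"
proof -
  let ?V = "verts G" and ?\<Sigma> = "verts G \<rightarrow>\<^sub>E {1, -1 :: int}"
  have finV: "finite ?V" and finH: "finite H"
    using finite_graph_simps assms by blast+
  have fin\<Sigma>: "finite ?\<Sigma>"
    using finV by (intro finite_PiE) auto
  let ?S = "\<Sum>\<sigma>\<in>?\<Sigma>. \<Prod>e\<in>H. 1 + edge_sign G \<sigma> e"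
  have "?S = (\<Sum>\<sigma>\<in>?\<Sigma>. if \<forall>e\<in>H. edge_sign G \<sigma> e = 1 then 2 ^ card H else 0)"
  proof (intro sum.cong refl)
    fix \<sigma> assume \<sigma>: "\<sigma> \<in> ?\<Sigma>"
    \<comment> \<open>Hence every factor \<open>1 + edge_sign G \<sigma> e\<close> is 0 or 2, and
      one zero factor kills the product.\<close>
    have "edge_sign G \<sigma> e \<in> {1, -1}" if e: "e \<in> H" for e
    proof -
      obtain u v where "ends G e = {u, v}" "u \<in> ?V" "v \<in> ?V"
        by (rule ends_cases[OF assms(1) subsetD[OF assms(2) e]])
      then have "edge_sign G \<sigma> e = \<sigma> u * \<sigma> v" "\<sigma> u \<in> {1, -1}" "\<sigma> v \<in> {1, -1}"
        using \<sigma> by (auto simp: edge_sign_eq finV)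
      then show ?thesis by auto
    qed
    then show "(\<Prod>e\<in>H. 1 + edge_sign G \<sigma> e) = (if \<forall>e\<in>H. edge_sign G \<sigma> e = 1 then 2 ^ card H else 0)"
      using finH by (force simp: prod_zero_iff)
  qed
  also have "\<dots> = 2 ^ card H * int (card {\<sigma>\<in>?\<Sigma>. \<forall>e\<in>H. edge_sign G \<sigma> e = 1})"
    using fin\<Sigma> by (simp flip: sum.inter_filter)
  also have "{\<sigma>\<in>?\<Sigma>. \<forall>e\<in>H. edge_sign G \<sigma> e = 1} = {\<sigma>\<in>?\<Sigma>. \<forall>(x, y)\<in>connected_rel G H. \<sigma> x = \<sigma> y}"
    using edge_sign_eq_1_iff[OF assms] by (intro Collect_cong conj_cong refl) blast
  also have "card \<dots> = 2 ^ card (graph_components G H)"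
    by (simp add: card_respecting_functions[OF equiv_connected_rel finV] graph_components_eq numeral_2_eq_2)
  finally have left: "?S = 2 ^ card H * 2 ^ card (graph_components G H)"
    by simp
  have "?S = (\<Sum>\<sigma>\<in>?\<Sigma>. \<Sum>F\<in>Pow H. \<Prod>x\<in>?V. \<sigma> x ^ vdegree G F x)"
  proof (intro sum.cong refl)
    fix \<sigma>
    have "(\<Prod>e\<in>H. 1 + edge_sign G \<sigma> e) = (\<Sum>F\<in>Pow H. \<Prod>e\<in>F. edge_sign G \<sigma> e)"
      using prod_add[OF finH, of "edge_sign G \<sigma>" "\<lambda>_. 1"] by (simp add: add.commute)
    also have "\<dots> = (\<Sum>F\<in>Pow H. \<Prod>x\<in>?V. \<sigma> x ^ vdegree G F x)"
      using finH by (intro sum.cong refl prod_edge_sign) (auto intro: finite_subset)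
    finally show "(\<Prod>e\<in>H. 1 + edge_sign G \<sigma> e) = \<dots>" .
  qed
  also have "\<dots> = (\<Sum>F\<in>Pow H. \<Sum>\<sigma>\<in>?\<Sigma>. \<Prod>x\<in>?V. \<sigma> x ^ vdegree G F x)"
    by (rule sum.swap)
  \<comment> \<open>The spins are summed independently. The factor at \<open>x\<close> becomes
    \<open>1 + (-1) ^ vdegree G F x\<close>, which is 2 or 0 according to parity.\<close>
  also have "\<dots> = (\<Sum>F\<in>Pow H. \<Prod>x\<in>?V. \<Sum>s\<in>{1, -1}. s ^ vdegree G F x)"
    by (intro sum.cong refl prod_sum_PiE[symmetric] finV) auto
  also have "\<dots> = (\<Sum>F\<in>Pow H. if F \<in> even_subsets G H then 2 ^ card ?V else 0)"
  proof (intro sum.cong refl)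
    fix F assume F: "F \<in> Pow H"
    have "(\<Prod>x\<in>?V. \<Sum>s\<in>{1, -1}. s ^ vdegree G F x) =
          (\<Prod>x\<in>?V. if even (vdegree G F x) then 2 else 0 :: int)"
      by (intro prod.cong refl) auto
    also have "\<dots> = (if F \<in> even_subsets G H then 2 ^ card ?V else 0)"
      using F finV by (auto simp: even_subsets_def prod_zero_iff)
    finally show "(\<Prod>x\<in>?V. \<Sum>s\<in>{1, -1}. s ^ vdegree G F x) =
        (if F \<in> even_subsets G H then 2 ^ card ?V else 0 :: int)" .
  qed
  also have "\<dots> = int (card (Pow H \<inter> even_subsets G H)) * 2 ^ card ?V"
    using finH by (simp add: sum.If_cases)
  also have "Pow H \<inter> even_subsets G H = even_subsets G H"
    by (auto simp: even_subsets_def)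
  finally have "int (card (even_subsets G H) * 2 ^ card ?V) =
      int (2 ^ card H * 2 ^ card (graph_components G H))"
    using left by simp
  then show ?thesis
    by (simp only: of_nat_eq_iff)
qed

text \<open>Apply the product formula to the spin assignment that is \<open>-1\<close> exactly on a component.\<close>

lemma W_even_if_odd_vertices:
  assumes "finite_graph G" "H \<subseteq> edges G" "D \<subseteq> H"
    and odd: "\<And>x. x \<in> verts G \<Longrightarrow> odd (vdegree G D x) \<longleftrightarrow> x \<in> W"
  shows "W_even G W H"
  unfolding W_even_def
proof
  fix C assume "C \<in> graph_components G H"
  then have C: "C \<in> verts G // connected_rel G H"
    by (simp add: graph_components_eq)
  have sub: "C \<subseteq> verts G"
    using C equiv_connected_rel by (metis in_quotient_imp_subset)
  define \<sigma> :: "_ \<Rightarrow> int" where "\<sigma> x = (if x \<in> C then -1 else 1)" for x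
  \<comment> \<open>Classes are closed under the relation; symmetry gives the converse
    direction.\<close>
  have "\<sigma> x = \<sigma> y" if "(x, y) \<in> connected_rel G H" for x y
    using in_quotient_imp_closed[OF equiv_connected_rel C] that
      equivE[OF equiv_connected_rel[of G H]] unfolding \<sigma>_def sym_def by metis
  then have "\<forall>e\<in>H. edge_sign G \<sigma> e = 1"
    using edge_sign_eq_1_iff[OF assms(1,2), of \<sigma>] by (auto simp: \<sigma>_def)
  \<comment> \<open>The same product, regrouped by vertices, is -1 to the number of odd vertices of
    \<open>D\<close> in \<open>C\<close>; comparing the two values gives the parity.\<close>
  then have "1 = (\<Prod>e\<in>D. edge_sign G \<sigma> e)"
    using assms(3) by (simp add: subset_eq)
  also have "\<dots> = (\<Prod>x\<in>verts G. \<sigma> x ^ vdegree G D x)"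
    using assms(1-3) by (intro prod_edge_sign) (meson finite_graph_simps(3) order_trans)
  also have "\<dots> = (\<Prod>x\<in>verts G. if x \<in> C \<inter> W then -1 else 1)"
    using odd by (intro prod.cong refl) (auto simp: \<sigma>_def minus_one_power_iff)
  also have "\<dots> = (-1) ^ card (C \<inter> W)"
  proof -
    have "verts G \<inter> {x. x \<in> C \<inter> W} = C \<inter> W"
      using sub by auto
    then show ?thesis
      using finite_graph_simps(1)[OF assms(1)] by (simp add: prod.If_cases)
  qed
  finally show "even (card (C \<inter> W))"
    by (cases "even (card (C \<inter> W))") simp_all
qed

section \<open>Sums of product weights\<close>

text \<open>Proportionality suffices: total mass 1 forces \<open>c\<close> to be the reciprocal of
  the normalizing sum, so no normalizing constant has to be evaluated.\<close>

lemma weighted_pmf_eqI: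
  assumes "finite A" "\<And>x. x \<in> A \<Longrightarrow> 0 \<le> w x"
    and "\<And>x. pmf M x = (if x \<in> A then c * w x else 0)"
  shows "M = weighted_pmf A w"
proof -
  have "set_pmf M \<subseteq> A"
    using assms(3) by (auto simp: set_pmf_iff split: if_splits)
  then have "(\<Sum>x\<in>A. pmf M x) = 1"
    using assms(1) by (intro sum_pmf_eq_1)
  then have c: "c * (\<Sum>x\<in>A. w x) = 1"
    using assms(3) by (simp add: sum_distrib_left)
  have "(\<Sum>x\<in>A. w x) \<ge> 0"
    using assms(2) by (simp add: sum_nonneg)
  moreover have "(\<Sum>x\<in>A. w x) \<noteq> 0"
    using c by auto
  ultimately have pos: "(\<Sum>x\<in>A. w x) > 0"
    by simp
  then have "c = 1 / (\<Sum>x\<in>A. w x)"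
    using c by (simp add: field_simps)
  then show ?thesis
    using assms pos by (intro pmf_eqI) (simp add: pmf_weighted_pmf)
qed

text \<open>The weight is a product over edges. Edges of \<open>D\<close> must be open and give
  \<open>s\<close>; each other edge is free and gives \<open>s + t\<close>.\<close>

lemma sum_configs_containing:
  fixes s t :: real
  assumes "finite (edges G)" "D \<subseteq> edges G"
  shows "(\<Sum>\<omega> | \<omega> \<in> configs G \<and> D \<subseteq> open_edges G \<omega>.
            s ^ card (open_edges G \<omega>) * t ^ card (edges G - open_edges G \<omega>)) =
         s ^ card D * (s + t) ^ card (edges G - D)"
proof -
  let ?E = "edges G"
  \<comment> \<open>The value 0 for a closed edge of \<open>D\<close> encodes the constraint
    \<open>D \<subseteq> open_edges G \<omega>\<close> in the product.\<close>
  define f where "f e n = (if n = (1::nat) then s else if e \<in> D then 0 else t)" for e n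
  have fin: "finite (configs G)"
    using assms by (auto simp: configs_def intro: finite_PiE)
  have "(\<Prod>e\<in>?E. f e (\<omega> e)) = (if D \<subseteq> open_edges G \<omega>
      then s ^ card (open_edges G \<omega>) * t ^ card (?E - open_edges G \<omega>) else 0)" for \<omega>
  proof (cases "D \<subseteq> open_edges G \<omega>")
    case True
    then have "(\<Prod>e\<in>?E. f e (\<omega> e)) = (\<Prod>e\<in>?E. if e \<in> open_edges G \<omega> then s else t)"
      by (intro prod.cong refl) (auto simp: f_def open_edges_def)
    also have "\<dots> = s ^ card (?E \<inter> open_edges G \<omega>) * t ^ card (?E - open_edges G \<omega>)"
      using assms(1) by (simp add: prod.If_cases Diff_eq)
    also have "?E \<inter> open_edges G \<omega> = open_edges G \<omega>"
      by (auto simp: open_edges_def)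
    finally show ?thesis
      using True by simp
  next
    case False
    then obtain e where "e \<in> D" "e \<notin> open_edges G \<omega>"
      by blast
    then have "e \<in> ?E" "f e (\<omega> e) = 0"
      using assms(2) by (auto simp: f_def open_edges_def)
    then show ?thesis
      using False assms(1) by (auto simp: prod_zero_iff)
  qed
  then have "(\<Sum>\<omega> | \<omega> \<in> configs G \<and> D \<subseteq> open_edges G \<omega>.
      s ^ card (open_edges G \<omega>) * t ^ card (?E - open_edges G \<omega>)) =
      (\<Sum>\<omega>\<in>configs G. \<Prod>e\<in>?E. f e (\<omega> e))"
    using fin by (simp add: sum.inter_filter)
  also have "\<dots> = (\<Prod>e\<in>?E. \<Sum>n\<in>{0, 1}. f e n)"
    unfolding configs_def using assms(1) by (intro prod_sum_PiE[symmetric]) auto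
  also have "\<dots> = (\<Prod>e\<in>?E. if e \<in> D then s else s + t)"
    by (intro prod.cong refl) (auto simp: f_def)
  also have "\<dots> = s ^ card D * (s + t) ^ card (?E - D)"
    using assms by (simp add: prod.If_cases Diff_eq Int_absorb1)
  finally show ?thesis .
qed

section \<open>The random even subgraph\<close>

text \<open>At each vertex the parity for \<open>edges G - F\<close> is the sum of those for
  \<open>edges G\<close> and \<open>F\<close>, so the complement has the odd vertices of
  \<open>G\<close> exactly if \<open>F\<close> has none.\<close>

lemma even_subset_iff_complement:
  assumes "finite_graph G" "F \<subseteq> edges G"
  shows "F \<in> even_subsets G (edges G) \<longleftrightarrow>
    (\<forall>x\<in>verts G. odd (vdegree G (edges G - F) x) \<longleftrightarrow> x \<in> odd_verts G)"
proof -
  have "sym_diff (edges G) F = edges G - F"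
    using assms(2) by blast
  then have "even (vdegree G (edges G - F) x) \<longleftrightarrow>
      (even (vdegree G (edges G) x) \<longleftrightarrow> even (vdegree G F x))" for x
    using even_vdegree_sym_diff[of "edges G" F G x] finite_graph_simps[OF assms(1)] assms(2) by simp
  then show ?thesis
    using assms(2) by (auto simp: even_subsets_def odd_verts_def)
qed

text \<open>Complementation and \<open>sym_diff\<close> with \<open>Q\<close> are involutions, which
  gives the inverse. Adding \<open>Q\<close> flips parity exactly at the odd vertices of
  \<open>G\<close>, turning even sets into complements of even sets and back.\<close>

lemma bij_betw_complement_sym_diff:
  assumes "finite_graph G" "H \<subseteq> edges G" "Q \<subseteq> H"
    and Q: "\<And>x. odd (vdegree G Q x) \<longleftrightarrow> x \<in> odd_verts G"
  shows "bij_betw (\<lambda>\<gamma>. edges G - sym_diff \<gamma> Q) (even_subsets G H)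
           {F \<in> even_subsets G (edges G). edges G - F \<subseteq> H}"
proof (rule bij_betw_byWitness[where f' = "\<lambda>F. sym_diff (edges G - F) Q"])
  let ?E = "edges G"
  have fin: "finite F" if "F \<subseteq> ?E" for F
    using finite_graph_simps(3)[OF assms(1) that] .
  have QE: "Q \<subseteq> ?E"
    using assms(2,3) by blast
  show "\<forall>\<gamma>\<in>even_subsets G H. sym_diff (?E - (?E - sym_diff \<gamma> Q)) Q = \<gamma>"
    using assms(2) QE by (auto simp: even_subsets_def)
  show "\<forall>F\<in>{F \<in> even_subsets G ?E. ?E - F \<subseteq> H}. ?E - sym_diff (sym_diff (?E - F) Q) Q = F"
    using QE by (auto simp: even_subsets_def)
  show "(\<lambda>\<gamma>. ?E - sym_diff \<gamma> Q) ` even_subsets G H \<subseteq> {F \<in> even_subsets G ?E. ?E - F \<subseteq> H}"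
  proof safe
    fix \<gamma> assume \<gamma>: "\<gamma> \<in> even_subsets G H"
    then have "\<gamma> \<subseteq> H" by (simp add: even_subsets_def)
    then have "?E - (?E - sym_diff \<gamma> Q) = sym_diff \<gamma> Q"
      using assms(2) QE by blast
    then show "?E - sym_diff \<gamma> Q \<in> even_subsets G ?E"
      using \<gamma> \<open>\<gamma> \<subseteq> H\<close> Q assms(2) QE
      by (subst even_subset_iff_complement[OF assms(1)])
        (auto simp: even_vdegree_sym_diff fin even_subsets_def)
  qed (use assms(3) in \<open>auto simp: even_subsets_def\<close>)
  show "(\<lambda>F. sym_diff (?E - F) Q) ` {F \<in> even_subsets G ?E. ?E - F \<subseteq> H} \<subseteq> even_subsets G H"
  proof
    fix \<gamma> assume "\<gamma> \<in> (\<lambda>F. sym_diff (?E - F) Q) ` {F \<in> even_subsets G ?E. ?E - F \<subseteq> H}"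
    then obtain F where F: "F \<in> even_subsets G ?E" "?E - F \<subseteq> H" and \<gamma>: "\<gamma> = sym_diff (?E - F) Q"
      by blast
    have "F \<subseteq> ?E" using F by (simp add: even_subsets_def)
    then have "\<forall>x\<in>verts G. odd (vdegree G (?E - F) x) \<longleftrightarrow> x \<in> odd_verts G"
      using F even_subset_iff_complement[OF assms(1)] by blast
    then have "\<forall>x\<in>verts G. even (vdegree G \<gamma> x)"
      unfolding \<gamma> using Q by (subst even_vdegree_sym_diff) (auto simp: fin QE)
    then show "\<gamma> \<in> even_subsets G H"
      unfolding \<gamma> even_subsets_def using F(2) assms(3) by blast
  qed
qed

theorem theorem3p2:
  fixes G :: "('v, 'e) graph"
    and W :: "'v set"
    and p r :: real
    and P :: "('e \<Rightarrow> nat) \<Rightarrow> nat \<Rightarrow> 'e set"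
    and PP :: "('e \<Rightarrow> nat) \<Rightarrow> 'e set"
  assumes "finite_graph G"
    and "W = odd_verts G"
    and "W \<noteq> {}"
    and "1 / 2 < p" "p < 1"
    and "r = 2 * (1 - p)"
    and "\<And>\<omega>. \<omega> \<in> W_even_configs G W \<Longrightarrow> W_pairing G W (open_edges G \<omega>) (P \<omega>)"
    and "\<And>\<omega>. \<omega> \<in> W_even_configs G W \<Longrightarrow> PP \<omega> = (\<Union>i\<in>{1..card W div 2}. P \<omega> i)"
  shows "bind_pmf (cond_pmf (random_cluster G r 2) (W_even_configs G W))
           (\<lambda>\<omega>. map_pmf (\<lambda>\<gamma>. edges G - sym_diff \<gamma> (PP \<omega>))
                   (pmf_of_set (even_subsets G (open_edges G \<omega>))))
         = random_even G p"
proof -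
  let ?E = "edges G" and ?\<Omega>W = "W_even_configs G W" and ?\<eta> = "open_edges G"
  let ?w = "\<lambda>\<omega>. r ^ card (?\<eta> \<omega>) * (1 - r) ^ card (?E - ?\<eta> \<omega>) * 2 ^ card (graph_components G (?\<eta> \<omega>))"
  let ?N = "\<lambda>\<omega>. card (even_subsets G (?\<eta> \<omega>))"
  define M where "M = cond_pmf (random_cluster G r 2) ?\<Omega>W"
  define K where "K \<omega> = map_pmf (\<lambda>\<gamma>. ?E - sym_diff \<gamma> (PP \<omega>)) (pmf_of_set (even_subsets G (?\<eta> \<omega>)))" for \<omega>
  note G = assms(1)
  note finE = finite_graph_simps(2)[OF G]
  have r: "0 < r" "r < 1"
    using assms(4-6) by auto
  have \<eta>: "?\<eta> \<omega> \<subseteq> ?E" for \<omega>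
    by (auto simp: open_edges_def)
  have fin: "finite (configs G)"
    unfolding configs_def using finE by (intro finite_PiE) auto
  have \<Omega>W: "?\<Omega>W \<subseteq> configs G"
    by (auto simp: W_even_configs_def)
  have fin\<Omega>W: "finite ?\<Omega>W"
    using fin \<Omega>W by (rule finite_subset[rotated])

  \<comment> \<open>This later allows the sum over \<open>?\<Omega>W\<close> to be replaced by one
    over all configurations.\<close>
  have W_even: "\<omega> \<in> ?\<Omega>W"
    if "\<omega> \<in> configs G" "F \<in> even_subsets G ?E" "?E - F \<subseteq> ?\<eta> \<omega>" for \<omega> F
  proof -
    have "F \<subseteq> ?E" using that by (simp add: even_subsets_def)
    then have "\<forall>x\<in>verts G. odd (vdegree G (?E - F) x) \<longleftrightarrow> x \<in> W"
      using that(2) even_subset_iff_complement[OF G] assms(2) by blast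
    then show ?thesis
      using W_even_if_odd_vertices[OF G \<eta> that(3)] that(1) by (simp add: W_even_configs_def)
  qed

  \<comment> \<open>The all-open configuration, with \<open>F = {}\<close>, shows that the
    conditioning event is non-empty. Its weight is positive, so the conditional law is well
    defined.\<close>
  have "(\<lambda>e\<in>?E. 1) \<in> configs G" "?\<eta> (\<lambda>e\<in>?E. 1) = ?E"
    by (simp_all add: configs_def open_edges_def)
  moreover have "{} \<in> even_subsets G ?E"
    by (simp add: even_subsets_def vdegree_def)
  ultimately have ne: "(\<lambda>e\<in>?E. 1) \<in> ?\<Omega>W"
    by (intro W_even[of _ "{}"]) simp_all

  have wpos: "?w \<omega> > 0" for \<omega>
    using r by (intro mult_pos_pos zero_less_power) simp_all
  define Z where "Z = (\<Sum>\<omega>\<in>configs G. ?w \<omega>)"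
  have "Z > 0"
    unfolding Z_def using fin wpos ne \<Omega>W by (intro sum_pos) auto
  then have rc: "pmf (random_cluster G r 2) \<omega> = (if \<omega> \<in> configs G then ?w \<omega> / Z else 0)" for \<omega>
    unfolding random_cluster_def Z_def using fin wpos
    by (subst pmf_weighted_pmf) (auto intro: less_imp_le)
  have "(\<lambda>e\<in>?E. 1) \<in> set_pmf (random_cluster G r 2)"
    unfolding set_pmf_iff rc if_P[OF subsetD[OF \<Omega>W ne]]
    using wpos[of "\<lambda>e\<in>?E. 1"] \<open>Z > 0\<close> by (intro divide_pos_pos[THEN less_imp_neq, THEN not_sym])
  then have "set_pmf (random_cluster G r 2) \<inter> ?\<Omega>W \<noteq> {}"
    using ne by blast
  then have set_M: "set_pmf M = set_pmf (random_cluster G r 2) \<inter> ?\<Omega>W"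
    and pmf_M_cond: "pmf M \<omega> = (if \<omega> \<in> ?\<Omega>W
      then pmf (random_cluster G r 2) \<omega> / measure (random_cluster G r 2) ?\<Omega>W else 0)" for \<omega>
    unfolding M_def by (simp_all add: set_cond_pmf pmf_cond)
  \<comment> \<open>\<open>c\<close> collects everything independent of \<omega>; its value does not
    matter for \<open>weighted_pmf_eqI\<close>.\<close>
  define c where "c = 1 / (Z * measure (random_cluster G r 2) ?\<Omega>W)"
  have pmf_M: "pmf M \<omega> = c * ?w \<omega>" if "\<omega> \<in> ?\<Omega>W" for \<omega>
    using that \<Omega>W by (auto simp: pmf_M_cond rc c_def)

  \<comment> \<open>A bijection carries the uniform law to the uniform law on its range, which has
    the same cardinality \<open>?N \<omega>\<close>.\<close>
  have pmf_K: "pmf (K \<omega>) F = (if F \<in> even_subsets G ?E \<and> ?E - F \<subseteq> ?\<eta> \<omega> then 1 / ?N \<omega> else 0)"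
    if \<omega>: "\<omega> \<in> ?\<Omega>W" for \<omega> F
  proof -
    have PP: "PP \<omega> = (\<Union>i\<in>{1..card W div 2}. P \<omega> i)" and pairing: "W_pairing G W (?\<eta> \<omega>) (P \<omega>)"
      using assms(7,8) \<omega> by blast+
    have "PP \<omega> \<subseteq> ?\<eta> \<omega>"
      using pairing unfolding PP W_pairing_def by blast
    moreover have "odd (vdegree G (PP \<omega>) x) \<longleftrightarrow> x \<in> odd_verts G" for x
      using even_vdegree_W_pairing[OF G \<eta> pairing, of x] assms(2) unfolding PP by blast
    ultimately have bij: "bij_betw (\<lambda>\<gamma>. ?E - sym_diff \<gamma> (PP \<omega>)) (even_subsets G (?\<eta> \<omega>))
        {F \<in> even_subsets G ?E. ?E - F \<subseteq> ?\<eta> \<omega>}"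
      using bij_betw_complement_sym_diff[OF G \<eta>] by blast
    have "{} \<in> even_subsets G (?\<eta> \<omega>)"
      by (simp add: even_subsets_def vdegree_def)
    moreover have fin\<eta>: "finite (even_subsets G (?\<eta> \<omega>))"
      using finE \<eta> by (meson finite_even_subsets finite_subset)
    ultimately have "K \<omega> = pmf_of_set {F \<in> even_subsets G ?E. ?E - F \<subseteq> ?\<eta> \<omega>}"
      using map_pmf_of_set_bij_betw[OF bij] unfolding K_def by blast
    moreover have "{F \<in> even_subsets G ?E. ?E - F \<subseteq> ?\<eta> \<omega>} \<noteq> {}"
      using bij_betw_apply[OF bij \<open>{} \<in> even_subsets G (?\<eta> \<omega>)\<close>] by blast
    moreover have "finite {F \<in> even_subsets G ?E. ?E - F \<subseteq> ?\<eta> \<omega>}"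
      using finite_even_subsets[OF finE, of G] by simp
    ultimately show ?thesis
      using bij_betw_same_card[OF bij] by (simp add: pmf_of_set indicator_def)
  qed

  \<comment> \<open>Counting even subsets cancels the component factor and leaves one factor 1/2 per
    open edge, which turns \<open>r\<close> into \<open>r / 2\<close>.\<close>
  have weight: "?w \<omega> / ?N \<omega> =
      2 ^ card (verts G) * ((r / 2) ^ card (?\<eta> \<omega>) * (1 - r) ^ card (?E - ?\<eta> \<omega>))" for \<omega>
  proof -
    have "real (?N \<omega>) * 2 ^ card (verts G) = 2 ^ card (?\<eta> \<omega>) * 2 ^ card (graph_components G (?\<eta> \<omega>))"
      using arg_cong[OF card_even_subsets[OF G \<eta>], of real] by simp
    moreover from this have "?N \<omega> \<noteq> 0"
      by (metis mult_eq_0_iff of_nat_0 power_not_zero zero_neq_numeral)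
    ultimately have "2 ^ card (graph_components G (?\<eta> \<omega>)) / real (?N \<omega>) = 2 ^ card (verts G) / 2 ^ card (?\<eta> \<omega>)"
      by (simp add: field_simps)
    then have "?w \<omega> / ?N \<omega> = r ^ card (?\<eta> \<omega>) * (1 - r) ^ card (?E - ?\<eta> \<omega>) *
        (2 ^ card (verts G) / 2 ^ card (?\<eta> \<omega>))"
      by (metis times_divide_eq_right)
    then show ?thesis
      by (simp add: power_divide)
  qed

  have "bind_pmf M K = random_even G p"
    unfolding random_even_def
  proof (rule weighted_pmf_eqI[where c = "c * 2 ^ card (verts G)"])
    show "finite (even_subsets G ?E)"
      using finE by (rule finite_even_subsets)
    show "0 \<le> p ^ card F * (1 - p) ^ card (?E - F)" for F
      using assms(4,5) by simp
    fix F
    have "pmf (bind_pmf M K) F = (\<Sum>\<omega>\<in>?\<Omega>W. pmf (K \<omega>) F * pmf M \<omega>)"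
      unfolding pmf_bind using fin\<Omega>W set_M by (subst integral_measure_pmf_real) auto
    also have "\<dots> = (\<Sum>\<omega>\<in>?\<Omega>W. if F \<in> even_subsets G ?E \<and> ?E - F \<subseteq> ?\<eta> \<omega> then c * (?w \<omega> / ?N \<omega>) else 0)"
      by (intro sum.cong refl) (simp add: pmf_K pmf_M)
    also have "\<dots> = (if F \<in> even_subsets G ?E
        then c * 2 ^ card (verts G) * (p ^ card F * (1 - p) ^ card (?E - F)) else 0)"
    proof (cases "F \<in> even_subsets G ?E")
      case True
      then have F: "F \<subseteq> ?E" "?E - (?E - F) = F"
        by (auto simp: even_subsets_def)
      have "(\<Sum>\<omega>\<in>?\<Omega>W. if F \<in> even_subsets G ?E \<and> ?E - F \<subseteq> ?\<eta> \<omega> then c * (?w \<omega> / ?N \<omega>) else 0) =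
          (\<Sum>\<omega> | \<omega> \<in> ?\<Omega>W \<and> ?E - F \<subseteq> ?\<eta> \<omega>. c * (?w \<omega> / ?N \<omega>))"
        using True fin\<Omega>W by (simp add: sum.inter_filter del: times_divide_eq_right)
      \<comment> \<open>The conditioning disappears here, so the edges outside \<open>?E - F\<close>
        can be summed freely.\<close>
      also have "{\<omega>. \<omega> \<in> ?\<Omega>W \<and> ?E - F \<subseteq> ?\<eta> \<omega>} = {\<omega>. \<omega> \<in> configs G \<and> ?E - F \<subseteq> ?\<eta> \<omega>}"
        using W_even[OF _ True] \<Omega>W by blast
      also have "(\<Sum>\<omega> | \<omega> \<in> configs G \<and> ?E - F \<subseteq> ?\<eta> \<omega>. c * (?w \<omega> / ?N \<omega>)) =
          c * 2 ^ card (verts G) * (\<Sum>\<omega> | \<omega> \<in> configs G \<and> ?E - F \<subseteq> ?\<eta> \<omega>.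
             (r / 2) ^ card (?\<eta> \<omega>) * (1 - r) ^ card (?E - ?\<eta> \<omega>))"
        unfolding weight by (simp add: sum_distrib_left mult.assoc)
      also have "\<dots> = c * 2 ^ card (verts G) * ((r / 2) ^ card (?E - F) * (r / 2 + (1 - r)) ^ card F)"
        using sum_configs_containing[OF finE, of "?E - F" "r / 2" "1 - r"] F(2) by simp
      also have "r / 2 = 1 - p"
        using assms(6) by simp
      \<comment> \<open>An edge of \<open>F\<close> may be open, with weight
        \<open>r / 2 = 1 - p\<close>, or closed, with weight \<open>1 - r = 2 * p - 1\<close>; the
        two add up to \<open>p\<close>.\<close>
      also have "1 - p + (1 - r) = p"
        using assms(6) by simp
      finally show ?thesis
        using True by (simp add: mult.commute)
    qed simp
    finally show "pmf (bind_pmf M K) F = (if F \<in> even_subsets G ?E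
        then c * 2 ^ card (verts G) * (p ^ card F * (1 - p) ^ card (?E - F)) else 0)" .
  qed
  then show ?thesis
    by (simp add: M_def K_def[abs_def])
qed

end
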